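(* Let $k\ge 1$ be an integer, let $g$ be a graph, let $S\subseteq V(g)$ be a nonempty $k$-defective clique, and let $lb\ge 0$ be an integer (the size of the currently found best solution). Let $u\in S$ and $v\in V(g)\setminus S$, and put $S'=S\cup\{v\}$ and $T=V(g)\setminus S'$. Let $cn(u,v)$ be the number of common neighbors of $u$ and $v$ in $T$, let $cnon(u,v)$ be the number of common non-neighbors of $u$ and $v$ in $T$, and let $xn(u,v)$ be the number of vertices of $T$ adjacent to exactly one of $u$ and $v$. If $$|S'|+cn(u,v)+\min\bigl(k-|\overline{E}(S')|,\,xn(u,v)\bigr)+\min\Bigl(cnon(u,v),\,\max\Bigl(0,\Bigl\lfloor\tfrac{k-|\overline{E}(S')|-xn(u,v)}{2}\Bigr\rfloor\Bigr)\Bigr)\le lb,$$ then $v$ can be removed from $g$; that is, every $k$-defective clique $C$ with $S\cup\{v\}\subseteq C\subseteq V(g)$ satisfies $|C|\le lb$.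
   Context: All graphs are finite, simple and undirected. For a vertex set $A\subseteq V(g)$, $\overline{E}(A)$ is the set of non-edges (unordered pairs of distinct non-adjacent vertices) of the subgraph of $g$ induced by $A$; $A$ is a $k$-defective clique if $|\overline{E}(A)|\le k$. A non-neighbor of a vertex $u$ is a vertex different from $u$ and not adjacent to $u$. In a branch-and-bound search for a maximum $k$-defective clique, with $lb$ the size of the best solution found so far, only solutions of size greater than $lb$ are of interest, so a vertex $v\in V(g)\setminus S$ "can be removed from $g$" if no $k$-defective clique of size greater than $lb$ in $g$ contains $S\cup\{v\}$. *)

theory Defs
  imports "Graph_Theory.Digraph_Component"
begin

text \<open>Finite simple undirected graphs are rendered by the locale \<open>graph\<close> of \<open>Graph_Theory\<close>:
  finite digraphs without loops and parallel arcs whose adjacency relation is symmetric, so that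
  an edge is a pair of opposite arcs and \<open>u \<rightarrow>\<^bsub>G\<^esub> v\<close> is adjacency.\<close>

definition nbrs :: "('a, 'b) pre_digraph \<Rightarrow> 'a \<Rightarrow> 'a set" where
  "nbrs G u = {w \<in> verts G. u \<rightarrow>\<^bsub>G\<^esub> w}"

definition non_nbrs :: "('a, 'b) pre_digraph \<Rightarrow> 'a \<Rightarrow> 'a set" where
  "non_nbrs G u = {w \<in> verts G. w \<noteq> u \<and> \<not> u \<rightarrow>\<^bsub>G\<^esub> w}"

definition non_edges :: "('a, 'b) pre_digraph \<Rightarrow> 'a set set" where
  "non_edges H = {{x, y} | x y. x \<in> verts H \<and> y \<in> verts H \<and> x \<noteq> y \<and> \<not> x \<rightarrow>\<^bsub>H\<^esub> y}"

definition defective_clique :: "('a, 'b) pre_digraph \<Rightarrow> nat \<Rightarrow> 'a set \<Rightarrow> bool" where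
  "defective_clique G k A \<longleftrightarrow> A \<subseteq> verts G \<and> card (non_edges (G \<restriction> A)) \<le> k"

definition common_nbrs_in :: "('a, 'b) pre_digraph \<Rightarrow> 'a set \<Rightarrow> 'a \<Rightarrow> 'a \<Rightarrow> nat" where
  "common_nbrs_in G T u v = card {w \<in> T. w \<in> nbrs G u \<and> w \<in> nbrs G v}"

definition common_non_nbrs_in :: "('a, 'b) pre_digraph \<Rightarrow> 'a set \<Rightarrow> 'a \<Rightarrow> 'a \<Rightarrow> nat" where
  "common_non_nbrs_in G T u v = card {w \<in> T. w \<in> non_nbrs G u \<and> w \<in> non_nbrs G v}"

definition exclusive_nbrs_in :: "('a, 'b) pre_digraph \<Rightarrow> 'a set \<Rightarrow> 'a \<Rightarrow> 'a \<Rightarrow> nat" where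
  "exclusive_nbrs_in G T u v = card {w \<in> T. (w \<in> nbrs G u) \<noteq> (w \<in> nbrs G v)}"

text \<open>No \<open>k\<close>-defective clique of size greater than \<open>lb\<close> contains \<open>S \<union> {v}\<close>.\<close>

definition can_be_removed ::
    "('a, 'b) pre_digraph \<Rightarrow> nat \<Rightarrow> nat \<Rightarrow> 'a set \<Rightarrow> 'a \<Rightarrow> bool" where
  "can_be_removed G k lb S v \<longleftrightarrow>
     \<not> (\<exists>C. defective_clique G k C \<and> card C > lb \<and> S \<union> {v} \<subseteq> C)"

end

theory Submission
  imports Defs
begin

text \<open>Let \<open>C\<close> be a \<open>k\<close>-defective clique containing \<open>S'\<close>. A vertex of \<open>C - S'\<close> causes no
  non-edge to \<open>{u, v}\<close> if it is a common neighbour, one if it is adjacent to exactly one of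
  \<open>u\<close>, \<open>v\<close>, and two if it is a common non-neighbour. If there are \<open>b\<close> vertices of the second kind
  and \<open>d\<close> of the third, these non-edges are distinct and not inside \<open>S'\<close>, so \<open>b + 2 d \<le> r\<close>; the
  bound is the maximum of \<open>b + d\<close> under this constraint, \<open>b \<le> xn\<close> and \<open>d \<le> cnon\<close>.\<close>

lemma non_edges_induce_subgraph:
  "non_edges (G \<restriction> A) = {{x, y} | x y. x \<in> A \<and> y \<in> A \<and> x \<noteq> y \<and> \<not> x \<rightarrow>\<^bsub>G\<^esub> y}"
proof -
  have "x \<rightarrow>\<^bsub>G \<restriction> A\<^esub> y \<longleftrightarrow> x \<rightarrow>\<^bsub>G\<^esub> y" if "x \<in> A" "y \<in> A" for x y
    using that by (auto simp: arcs_ends_def arc_to_ends_def induce_subgraph_def image_iff)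
  then show ?thesis
    unfolding non_edges_def by auto
qed

lemma finite_non_edges_induce_subgraph:
  assumes "finite A"
  shows "finite (non_edges (G \<restriction> A))"
proof (rule finite_subset)
  show "non_edges (G \<restriction> A) \<subseteq> Pow A"
    by (auto simp: non_edges_induce_subgraph)
qed (use assms in simp)

text \<open>Every \<open>w\<close> outside \<open>A\<close> that is not adjacent to \<open>u\<close>
  gives the non-edge \<open>{u, w}\<close>, and likewise for \<open>v\<close>. These pairs leave
  \<open>A\<close>, so none lies within \<open>A\<close>. A \<open>w\<close> missed by both ends is
  rightly counted twice.\<close>

lemma card_non_edges_extend:
  assumes "finite C" "A \<subseteq> C" "u \<in> A" "v \<in> A" "u \<noteq> v"
  shows "card (non_edges (G \<restriction> A)) + card {w \<in> C - A. \<not> u \<rightarrow>\<^bsub>G\<^esub> w} + card {w \<in> C - A. \<not> v \<rightarrow>\<^bsub>G\<^esub> w}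
    \<le> card (non_edges (G \<restriction> C))"
proof -
  define N where "N x = {w \<in> C - A. \<not> x \<rightarrow>\<^bsub>G\<^esub> w}" for x
  define F where "F x = (\<lambda>w. {x, w}) ` N x" for x
  have finN: "finite (N x)" for x
    using assms(1) by (simp add: N_def)
  have cardF: "card (F x) = card (N x)" for x
    unfolding F_def by (rule card_image) (auto simp: inj_on_def doubleton_eq_iff)
  have finF: "finite (F x)" for x
    using finN by (simp add: F_def)
  have finA: "finite (non_edges (G \<restriction> A))"
    using assms(1,2) by (intro finite_non_edges_induce_subgraph) (rule finite_subset)
  \<comment> \<open>As \<open>u\<close> and \<open>v\<close> differ, \<open>{u, w} = {v, w'}\<close>
    would force \<open>w' = u\<close>, but \<open>w'\<close> lies outside \<open>A\<close>.\<close>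
  have dis: "F u \<inter> F v = {}"
    using assms by (auto simp: F_def N_def doubleton_eq_iff)
  have dis': "non_edges (G \<restriction> A) \<inter> (F u \<union> F v) = {}"
    by (auto simp: F_def N_def non_edges_induce_subgraph doubleton_eq_iff)
  have "F x \<subseteq> non_edges (G \<restriction> C)" if "x \<in> A" for x
    using that assms(2) by (auto simp: F_def N_def non_edges_induce_subgraph)
  moreover have "non_edges (G \<restriction> A) \<subseteq> non_edges (G \<restriction> C)"
    using assms(2) by (auto simp: non_edges_induce_subgraph)
  ultimately have "card (non_edges (G \<restriction> A) \<union> (F u \<union> F v)) \<le> card (non_edges (G \<restriction> C))"
    using assms by (intro card_mono finite_non_edges_induce_subgraph) auto
  also have "card (non_edges (G \<restriction> A) \<union> (F u \<union> F v))
      = card (non_edges (G \<restriction> A)) + (card (N u) + card (N v))"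
    using finA finF dis dis' by (simp add: card_Un_disjoint cardF)
  finally show ?thesis
    by (simp add: N_def)
qed

theorem mainTheorem4:
  fixes G :: "('a, 'b) pre_digraph"
    and k lb :: nat
    and S S' T :: "'a set"
    and u v :: 'a
    and r cn cnon xn :: int
  assumes "k \<ge> 1"
    and "graph G"
    and "S \<noteq> {}"
    and "defective_clique G k S"
    and "u \<in> S"
    and "v \<in> verts G - S"
    and "S' = S \<union> {v}"
    and "T = verts G - S'"
    and "cn = int (common_nbrs_in G T u v)"
    and "cnon = int (common_non_nbrs_in G T u v)"
    and "xn = int (exclusive_nbrs_in G T u v)"
    and "r = int k - int (card (non_edges (G \<restriction> S')))"
    and "int (card S') + cn + min r xn + min cnon (max 0 ((r - xn) div 2)) \<le> int lb"
  shows "can_be_removed G k lb S v \<and>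
    (\<forall>C. defective_clique G k C \<and> S \<union> {v} \<subseteq> C \<longrightarrow> card C \<le> lb)"
proof -
  have "card C \<le> lb" if C: "defective_clique G k C" and sub: "S \<union> {v} \<subseteq> C" for C
  proof -
    interpret graph G by fact
    have CV: "C \<subseteq> verts G" and Ck: "card (non_edges (G \<restriction> C)) \<le> k"
      using C by (auto simp: defective_clique_def)
    have finC: "finite C"
      using CV finite_verts by (rule finite_subset)
    have finT: "finite T"
      using assms(8) by simp
    have S'C: "S' \<subseteq> C"
      using sub assms(7) by simp
    define A where "A = {w \<in> C - S'. u \<rightarrow>\<^bsub>G\<^esub> w \<and> v \<rightarrow>\<^bsub>G\<^esub> w}"
    define B where "B = {w \<in> C - S'. (u \<rightarrow>\<^bsub>G\<^esub> w) \<noteq> (v \<rightarrow>\<^bsub>G\<^esub> w)}"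
    define D where "D = {w \<in> C - S'. \<not> u \<rightarrow>\<^bsub>G\<^esub> w \<and> \<not> v \<rightarrow>\<^bsub>G\<^esub> w}"
    have fin: "finite A" "finite B" "finite D"
      using finC by (auto simp: A_def B_def D_def)
    have "card C = card (S' \<union> (A \<union> (B \<union> D)))"
      using S'C by (intro arg_cong[of _ _ card]) (auto simp: A_def B_def D_def)
    also have "\<dots> = card S' + card (A \<union> (B \<union> D))"
      using fin finite_subset[OF S'C finC]
      by (intro card_Un_disjoint) (auto simp: A_def B_def D_def)
    also have "card (A \<union> (B \<union> D)) = card A + card (B \<union> D)"
      using fin by (intro card_Un_disjoint) (auto simp: A_def B_def D_def)
    also have "card (B \<union> D) = card B + card D"
      using fin by (intro card_Un_disjoint) (auto simp: B_def D_def)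
    finally have cardC: "card C = card S' + card A + card B + card D"
      by simp
    \<comment> \<open>\<open>C - S'\<close> is contained in \<open>T\<close>, so each class is a
      subset of the set whose size bounds it.\<close>
    have "int (card A) \<le> cn"
      unfolding assms(9) common_nbrs_in_def of_nat_le_iff
      using CV finT by (intro card_mono) (auto simp: A_def assms(8) nbrs_def)
    moreover have "int (card B) \<le> xn"
      unfolding assms(11) exclusive_nbrs_in_def of_nat_le_iff
      using CV finT by (intro card_mono) (auto simp: B_def assms(8) nbrs_def)
    \<comment> \<open>\<open>non_nbrs\<close> excludes the vertex itself; \<open>u\<close> and
      \<open>v\<close> lie in \<open>S'\<close>, so no member of \<open>D\<close> equals
      either.\<close>
    moreover have "int (card D) \<le> cnon"
      unfolding assms(10) common_non_nbrs_in_def of_nat_le_iff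
      using CV finT assms(5,7) by (intro card_mono) (auto simp: D_def assms(8) non_nbrs_def)
    moreover have "int (card B) + 2 * int (card D) \<le> r"
    proof -
      \<comment> \<open>\<open>Nu\<close> and \<open>Nv\<close> overlap exactly in \<open>D\<close>,
        which explains the factor 2.\<close>
      define Nu where "Nu = {w \<in> C - S'. \<not> u \<rightarrow>\<^bsub>G\<^esub> w}"
      define Nv where "Nv = {w \<in> C - S'. \<not> v \<rightarrow>\<^bsub>G\<^esub> w}"
      have "Nu \<union> Nv = B \<union> D" "Nu \<inter> Nv = D"
        by (auto simp: Nu_def Nv_def B_def D_def)
      moreover have "finite Nu" "finite Nv"
        using finC by (auto simp: Nu_def Nv_def)
      ultimately have "card Nu + card Nv = card B + 2 * card D"
        using card_Un_Int[of Nu Nv] \<open>card (B \<union> D) = card B + card D\<close> by simp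
      moreover have "card (non_edges (G \<restriction> S')) + card Nu + card Nv \<le> card (non_edges (G \<restriction> C))"
        unfolding Nu_def Nv_def
        using finC S'C assms(5-7) by (intro card_non_edges_extend) auto
      ultimately show ?thesis
        using Ck assms(12) by linarith
    qed
    \<comment> \<open>Let \<open>b\<close> and \<open>d\<close> be the sizes of \<open>B\<close> and
      \<open>D\<close>. If \<open>r \<le> xn\<close>, the last summand is 0 and
      \<open>b + d \<le> b + 2 d \<le> r\<close>. Otherwise \<open>b + d \<le> xn + cnon\<close>,
      and \<open>2 (b + d) = b + (b + 2 d) \<le> xn + r\<close> gives
      \<open>b + d \<le> xn + (r - xn) div 2\<close>.\<close>
    ultimately have "int (card C) \<le> int (card S') + cn + min r xn + min cnon (max 0 ((r - xn) div 2))"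
      using cardC by (auto simp: min_def max_def)
    with assms(13) show ?thesis
      by linarith
  qed
  then show ?thesis
    unfolding can_be_removed_def by (meson not_le)
qed

end
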